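(* Let $\{A_k\}$ be a finite or countable family of closed subsets of $\mathbb{R}^d$. Then $$\dim_{\mathrm{FC}}\Big(\bigcup_k A_k\Big)=\sup_k\dim_{\mathrm{FC}}A_k.$$
   Context: For a finite Borel measure $\mu$ on $\mathbb{R}^d$, $\widehat\mu(\xi)=\int e^{-2\pi i \xi\cdot x}\,d\mu(x)$ for $\xi\in\mathbb{R}^d$. The notation $f(\xi)\lesssim g(\xi)$ means there is a constant $C$ with $|f(\xi)|\le C|g(\xi)|$ for all $\xi$ (negative powers of $|\xi|$ are read as $+\infty$ at $\xi=0$). For a Borel set $A\subset\mathbb{R}^d$, $\mathcal{P}(A)$ is the set of Borel probability measures $\mu$ on $\mathbb{R}^d$ with $\mu(A)=1$. The compact Fourier dimension of $A$ is $\dim_{\mathrm{FC}}A=\sup\{s\in[0,d]:\ \widehat\mu(\xi)\lesssim|\xi|^{-s/2}\text{ for some }\mu\in\mathcal{P}(K)\text{ with }K\subset A\text{ compact}\}$. Suprema of empty sets of dimensions are $0$. *)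

theory Defs
  imports "HOL-Probability.Probability"
begin

definition fourier_measure :: "'a::euclidean_space measure \<Rightarrow> 'a \<Rightarrow> complex" where
  "fourier_measure \<mu> \<xi> = (LINT x|\<mu>. exp (- 2 * of_real pi * \<i> * of_real (\<xi> \<bullet> x)))"

definition borel_probs :: "'a::euclidean_space set \<Rightarrow> 'a measure set" where
  "borel_probs A = {\<mu>. sets \<mu> = sets borel \<and> prob_space \<mu> \<and> emeasure \<mu> A = 1}"

text \<open>
  The point \<open>\<xi> = 0\<close> is left out: for \<open>s > 0\<close> the right-hand side is
  \<open>+\<infinity>\<close> there (whereas \<open>0 powr a = 0\<close> in HOL), and for \<open>s = 0\<close>
  it is the constant \<open>C\<close>, so that the condition at this one point only enlarges \<open>C\<close>.
\<close>
definition fourier_decay :: "'a::euclidean_space measure \<Rightarrow> real \<Rightarrow> bool" where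
  "fourier_decay \<mu> s \<longleftrightarrow>
     (\<exists>C::real. \<forall>\<xi>. \<xi> \<noteq> 0 \<longrightarrow> norm (fourier_measure \<mu> \<xi>) \<le> C * norm \<xi> powr (- s / 2))"

text \<open>
  Supremum of a set of dimensions. On \<^typ>\<open>real\<close> the value \<open>Sup {}\<close> is unspecified;
  here it is \<open>0\<close>. All sets it is applied to are contained in \<open>{0..d}\<close>.
\<close>
definition dim_Sup :: "real set \<Rightarrow> real" where
  "dim_Sup X = (if X = {} then 0 else Sup X)"

definition compact_fourier_dim :: "'a::euclidean_space set \<Rightarrow> real" where
  "compact_fourier_dim A = dim_Sup {s \<in> {0..real DIM('a)}.
     \<exists>K \<mu>. compact K \<and> K \<subseteq> A \<and> \<mu> \<in> borel_probs K \<and> fourier_decay \<mu> s}"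

lemma compact_fourier_dim_bounds:
  fixes A :: "'a::euclidean_space set"
  shows "compact_fourier_dim A \<in> {0..real DIM('a)}"
proof -
  have "dim_Sup X \<in> {0..c}" if "X \<subseteq> {0..c}" "0 \<le> c" for X :: "real set" and c
  proof (cases "X = {}")
    case False
    then obtain x where "x \<in> X" by blast
    moreover have "bdd_above X" using that(1) by (meson bdd_above_Icc bdd_above_mono)
    ultimately have "0 \<le> Sup X" using that(1) by (meson atLeastAtMost_iff cSup_upper2 subsetD)
    moreover have "Sup X \<le> c" using False that(1) by (intro cSup_least) auto
    ultimately show ?thesis using False by (simp add: dim_Sup_def)
  qed (use that in \<open>simp add: dim_Sup_def\<close>)
  then show ?thesis unfolding compact_fourier_dim_def by (rule) auto
qed

end

theory Submission
  imports Defs "HOL-Computational_Algebra.Polynomial"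
begin

text \<open>
  A compactly supported measure of the union is charged, near some point of its support, only by
  one \<open>A k\<close>: this is Baire's theorem applied to the support. Multiplying the measure by a bump
  function that lives near this point gives a measure on a compact subset of \<open>A k\<close>.
  Multiplication by \<open>h = (\<lambda>t. LBINT u. g u * cis (u * t))\<close> in a coordinate turns the Fourier
  transform into the average of its translates with weight \<open>g\<close>, and a translation by \<open>v\<close> changes
  \<open>(1 + norm \<xi>) powr (-a)\<close> by at most the factor \<open>(1 + norm v) powr a\<close>. So the decay survives
  as soon as \<open>g\<close> has enough moments, which holds for \<open>h t = max 0 (1 - t\<^sup>2) ^ k\<close>.
\<close>

section \<open>Fourier inversion on the real line\<close>

text \<open>A majorant of product form is integrable on the product space, so joint integrability
  reduces to two one-variable conditions.\<close>

lemma (in pair_sigma_finite) Fubini_integral_dominated: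
  fixes f :: "_ \<Rightarrow> _ \<Rightarrow> _::{banach, second_countable_topology}" and a b :: "_ \<Rightarrow> real"
  assumes f [measurable]: "case_prod f \<in> borel_measurable (M1 \<Otimes>\<^sub>M M2)"
    and a: "integrable M1 a" and b: "integrable M2 b"
    and le: "\<And>x y. norm (f x y) \<le> a x * b y"
  shows "(LINT y|M2. LINT x|M1. f x y) = (LINT x|M1. LINT y|M2. f x y)"
proof (rule Fubini_integral)
  have [measurable]: "a \<in> borel_measurable M1" "b \<in> borel_measurable M2"
    using a b by auto
  have "integrable (M1 \<Otimes>\<^sub>M M2) (\<lambda>(x, y). a x * b y)"
  proof (rule Fubini_integrable)
    show "integrable M1 (\<lambda>x. LINT y|M2. norm (case (x, y) of (x, y) \<Rightarrow> a x * b y))"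
      using a b by (simp add: abs_mult)
  qed (use b in auto)
  then show "integrable (M1 \<Otimes>\<^sub>M M2) (case_prod f)"
  proof (rule Bochner_Integration.integrable_bound)
    show "AE z in M1 \<Otimes>\<^sub>M M2. norm (case_prod f z) \<le> norm (case z of (x, y) \<Rightarrow> a x * b y)"
      using le by (auto intro!: AE_I2 order_trans[OF le])
  qed auto
qed

lemma borel_measurable_cis [measurable]: "cis \<in> borel_measurable borel"
  by (intro borel_measurable_continuous_onI continuous_intros)

text \<open>The substitution \<open>u = v / e\<close> reduces this to the characteristic function of
  the standard normal distribution.\<close>

lemma integral_cis_gaussian:
  fixes z e :: real
  assumes "e > 0"
  shows "(LBINT u. cis (u * z) * exp (- (e * u)\<^sup>2 / 2)) = sqrt (2 * pi) / e * exp (- (z / e)\<^sup>2 / 2)"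
proof -
  have "(LBINT v. std_normal_density v *\<^sub>R cis (t * v)) = exp (- t\<^sup>2 / 2)" for t
    using fun_cong[OF char_std_normal_distribution, of t]
    by (simp add: char_def integral_density cis_conv_exp)
  note density = this
  have *: "(LBINT v. cis (t * v) * exp (- v\<^sup>2 / 2)) = sqrt (2 * pi) * exp (- t\<^sup>2 / 2)" for t
    using density[of t] by (simp add: std_normal_density_def scaleR_conv_of_real field_simps)
  have "(LBINT u. cis (u * z) * exp (- (e * u)\<^sup>2 / 2))
      = (1 / e) *\<^sub>R (LBINT v. cis (v * (z / e)) * exp (- v\<^sup>2 / 2))"
    using assms by (subst lborel_integral_real_affine[of "1 / e" _ 0]) simp_all
  also have "\<dots> = sqrt (2 * pi) / e * exp (- (z / e)\<^sup>2 / 2)"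
    using *[of "z / e"] by (simp add: scaleR_conv_of_real mult_ac)
  finally show ?thesis .
qed

lemma integrable_gaussian:
  fixes e :: real
  assumes "e > 0"
  shows "integrable lborel (\<lambda>u. exp (- (e * u)\<^sup>2 / 2))"
proof -
  have "integrable lborel (\<lambda>v. sqrt (2 * pi) * std_normal_density v)"
    by simp
  then have "integrable lborel (\<lambda>v::real. exp (- v\<^sup>2 / 2))"
    by (simp add: std_normal_density_def)
  from lborel_integrable_real_affine[OF this, of e 0] show ?thesis using assms by simp
qed

text \<open>The inversion formula is exact for the Gaussian, so inserting the factor
  \<open>exp (- (e * u)\<^sup>2 / 2)\<close> and letting \<open>e\<close> tend to \<open>0\<close> proves it for \<open>f\<close>.\<close>
lemma fourier_inversion:
  fixes f :: "real \<Rightarrow> real" and F :: "real \<Rightarrow> complex"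
  defines "F \<equiv> (\<lambda>u. LBINT y. f y * cis (- (u * y)))"
  assumes cont: "continuous_on UNIV f" and bdd: "\<And>x. \<bar>f x\<bar> \<le> B"
    and int: "integrable lborel f" and F: "integrable lborel F"
  shows "of_real (f x) = (LBINT u. F u / (2 * pi) * cis (u * x))"
proof -
  \<comment> \<open>Dominated convergence is applied along sequences, so the width of the Gaussian
    runs through \<open>1 / (n + 1)\<close>.\<close>
  define e where "e n = 1 / real (Suc n)" for n
  have e: "e n > 0" for n by (simp add: e_def)
  have e0: "e \<longlonglongrightarrow> 0"
    using LIMSEQ_inverse_real_of_nat by (simp add: e_def[abs_def] inverse_eq_divide)
  have [measurable]: "f \<in> borel_measurable borel" "F \<in> borel_measurable borel"
    using int F by auto
  \<comment> \<open>The limit of these regularized integrals is computed twice: after exchanging the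
    integrals, as averages of \<open>f\<close> against Gaussians concentrating at \<open>x\<close>,
    and directly, with majorant \<open>norm (F u)\<close>.\<close>
  define A :: "nat \<Rightarrow> complex"
    where "A n = (LBINT u. F u * cis (u * x) * exp (- (e n * u)\<^sup>2 / 2))" for n
  have A_eq: "A n = sqrt (2 * pi) * (LBINT z. f (x + e n * z) * exp (- z\<^sup>2 / 2))" for n
  proof -
    let ?g = "\<lambda>u. exp (- (e n * u)\<^sup>2 / 2) :: real"
    have "A n = (LBINT u. LBINT y. f y * cis (u * (x - y)) * ?g u)"
    proof -
      have "cis (u * (x - y)) = cis (- (u * y)) * cis (u * x)" for u y
        by (simp add: cis_mult right_diff_distrib)
      then show ?thesis
        unfolding A_def F_def
        by (simp add: mult.assoc flip: integral_mult_left_zero)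
    qed
    \<comment> \<open>The Gaussian factor supplies the integrability in \<open>u\<close>; the bare
      wave has modulus 1.\<close>
    also have "\<dots> = (LBINT y. LBINT u. f y * cis (u * (x - y)) * ?g u)"
      by (rule lborel_pair.Fubini_integral_dominated[where a = "\<lambda>y. \<bar>f y\<bar>" and b = ?g])
        (use int integrable_gaussian[OF e] in \<open>auto simp: norm_mult\<close>)
    also have "\<dots> = (LBINT y. f y * (sqrt (2 * pi) / e n * exp (- ((x - y) / e n)\<^sup>2 / 2)))"
      by (simp only: mult.assoc integral_mult_right_zero integral_cis_gaussian[OF e]
          integral_complex_of_real flip: of_real_mult)
    \<comment> \<open>Substitution \<open>y = x + e n * z\<close>; its Jacobian cancels the factor
      \<open>1 / e n\<close>.\<close>
    also have "\<dots> = e n *\<^sub>R (LBINT z. f (x + e n * z) * (sqrt (2 * pi) / e n * exp (- z\<^sup>2 / 2)))"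
      using e[of n] by (subst lborel_integral_real_affine[of "e n" _ x]) (simp_all flip: integral_complex_of_real of_real_mult)
    also have "\<dots> = sqrt (2 * pi) * (LBINT z. f (x + e n * z) * exp (- z\<^sup>2 / 2))"
      using e[of n] by (simp add: mult.left_commute[of _ "sqrt (2 * pi)"])
    finally show ?thesis .
  qed
  have "(\<lambda>n. LBINT z. f (x + e n * z) * exp (- z\<^sup>2 / 2))
      \<longlonglongrightarrow> (LBINT z. f x * exp (- z\<^sup>2 / 2))"
  proof (rule integral_dominated_convergence[where w = "\<lambda>z. B * exp (- z\<^sup>2 / 2)"])
    show "integrable lborel (\<lambda>z. B * exp (- z\<^sup>2 / 2))"
      using integrable_gaussian[of 1] by simp
    have "(\<lambda>n. f (x + e n * z)) \<longlonglongrightarrow> f x" for z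
    proof -
      have "(\<lambda>n. x + e n * z) \<longlonglongrightarrow> x + 0 * z"
        using e0 by (intro tendsto_intros)
      then show ?thesis
        using continuous_on_tendsto_compose[OF cont] by force
    qed
    then show "AE z in lborel. (\<lambda>n. f (x + e n * z) * exp (- z\<^sup>2 / 2)) \<longlonglongrightarrow> f x * exp (- z\<^sup>2 / 2)"
      by (auto intro!: tendsto_intros)
  qed (use bdd in \<open>auto simp: abs_mult mult_right_mono\<close>)
  moreover have "(LBINT z. exp (- z\<^sup>2 / 2)) = sqrt (2 * pi)"
    using integral_cis_gaussian[of 1 0]
    by (simp flip: of_real_exp)
  \<comment> \<open>One \<open>sqrt (2 * pi)\<close> comes from the transform of the Gaussian, the
    other from its total mass; together they give the \<open>2 * pi\<close> of the inversion
    formula.\<close>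
  ultimately have "A \<longlonglongrightarrow> of_real (sqrt (2 * pi) * (f x * sqrt (2 * pi)))"
    unfolding A_eq[abs_def] by (intro tendsto_of_real tendsto_mult_left) simp
  moreover have "A \<longlonglongrightarrow> (LBINT u. F u * cis (u * x))"
    unfolding A_def
  proof (rule integral_dominated_convergence[where w = "\<lambda>u. norm (F u)"])
    have "(\<lambda>n. exp (- (e n * u)\<^sup>2 / 2)) \<longlonglongrightarrow> 1" for u
    proof -
      have "(\<lambda>n. exp (- (e n * u)\<^sup>2 / 2)) \<longlonglongrightarrow> exp (- (0 * u)\<^sup>2 / 2)"
        using e0 by (intro tendsto_intros) auto
      then show ?thesis by simp
    qed
    then have "(\<lambda>n. F u * cis (u * x) * of_real (exp (- (e n * u)\<^sup>2 / 2))) \<longlonglongrightarrow> F u * cis (u * x) * of_real 1" for u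
      by (intro tendsto_intros)
    then show "AE u in lborel. (\<lambda>n. F u * cis (u * x) * of_real (exp (- (e n * u)\<^sup>2 / 2))) \<longlonglongrightarrow> F u * cis (u * x)"
      by simp
  qed (use F in \<open>auto simp: norm_mult mult_left_le\<close>)
  ultimately have "(LBINT u. F u * cis (u * x)) = of_real (sqrt (2 * pi) * (f x * sqrt (2 * pi)))"
    using LIMSEQ_unique by blast
  also have "\<dots> = of_real (2 * pi) * of_real (f x)"
    by (simp add: mult_ac flip: of_real_mult)
  finally show ?thesis by (simp add: field_simps)
qed

section \<open>A bump function with a prescribed number of Fourier moments\<close>

text \<open>Each factor \<open>1 - x\<^sup>2\<close> allows one integration by parts without boundary terms.\<close>
lemma fourier_poly_decay:
  fixes p :: "real poly"
  shows "\<exists>C. \<forall>u. \<bar>u\<bar> ^ k * norm (LBINT x:{-1..1}. poly (p * [:1, 0, -1:] ^ k) x * cis (- (u * x))) \<le> C"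
proof (induction k arbitrary: p)
  case 0
  have "norm (LBINT x:{-1..1}. poly p x * cis (- (u * x))) \<le> (LBINT x:{-1..1}. \<bar>poly p x\<bar>)" for u
  proof -
    have "set_integrable lborel {-1..1} (\<lambda>x. poly p x * cis (- (u * x)))"
      by (intro borel_integrable_atLeastAtMost' continuous_intros)
    from set_integral_norm_bound[OF this] show ?thesis
      by (simp add: norm_mult)
  qed
  then show ?case by auto
next
  case (Suc k)
  let ?w = "[:1, 0, -1:] :: real poly"
  define P where "P = p * ?w ^ Suc k"
  \<comment> \<open>The product rule leaves \<open>k\<close> factors \<open>?w\<close> in the
    derivative of \<open>P\<close>. Its cofactor \<open>q\<close> is again a polynomial, which is
    why the induction runs over all \<open>p\<close>.\<close>
  define q where "q = pderiv p * ?w + smult (of_nat (Suc k)) (p * pderiv ?w)"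
  have P': "pderiv P = q * ?w ^ k"
    unfolding P_def q_def pderiv_mult pderiv_power_Suc by (simp add: algebra_simps)
  obtain C where C: "\<And>u. \<bar>u\<bar> ^ k * norm (LBINT x:{-1..1}. poly (pderiv P) x * cis (- (u * x))) \<le> C"
    using Suc.IH[of q] unfolding P' by blast
  have "\<bar>u\<bar> ^ Suc k * norm (LBINT x:{-1..1}. poly P x * cis (- (u * x))) \<le> C" for u
  proof -
    let ?E = "\<lambda>x. cis (- (u * x))"
    have P1: "poly P 1 = 0" "poly P (-1) = 0"
      by (simp_all add: P_def)
    have "((\<lambda>x. poly P x * ?E x) has_vector_derivative
        (poly (pderiv P) x * ?E x - \<i> * u * (poly P x * ?E x))) (at x within {-1..1})" for x
    proof -
      have "((\<lambda>x. of_real (poly P x) :: complex) has_vector_derivative of_real (poly (pderiv P) x)) (at x within {-1..1})"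
        by (rule has_vector_derivative_of_real[OF has_field_derivative_at_within[OF poly_DERIV]])
      moreover have "(?E has_vector_derivative (- \<i> * u * ?E x)) (at x within {-1..1})"
        using exp_scaleR_has_vector_derivative_right[of "- \<i> * u" x "{-1..1}"]
        by (simp add: cis_conv_exp scaleR_conv_of_real mult_ac)
      ultimately show ?thesis
        using has_vector_derivative_mult by (fastforce simp: algebra_simps)
    qed
    then have "(LBINT x:{-1..1}. poly (pderiv P) x * ?E x - \<i> * u * (poly P x * ?E x)) = 0"
      unfolding set_lebesgue_integral_def
      by (subst integral_FTC_atLeastAtMost[where F = "\<lambda>x. poly P x * ?E x"])
        (auto simp: P1 intro!: continuous_intros)
    moreover have "set_integrable lborel {-1..1} (\<lambda>x. poly (pderiv P) x * ?E x)"
      "set_integrable lborel {-1..1} (\<lambda>x. \<i> * u * (poly P x * ?E x))"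
      by (intro borel_integrable_atLeastAtMost' continuous_intros)+
    ultimately have "(LBINT x:{-1..1}. poly (pderiv P) x * ?E x) = \<i> * u * (LBINT x:{-1..1}. poly P x * ?E x)"
      by (subst (asm) set_integral_diff) simp_all
    then have "norm (LBINT x:{-1..1}. poly (pderiv P) x * ?E x) = \<bar>u\<bar> * norm (LBINT x:{-1..1}. poly P x * ?E x)"
      by (simp add: norm_mult)
    then show ?thesis using C[of u] by (simp add: mult_ac)
  qed
  then show ?case unfolding P_def by blast
qed

text \<open>Since \<open>1 + \<bar>u\<bar> \<le> 2 * max 1 \<bar>u\<bar>\<close>. It combines bounds
  on a function and on its product with \<open>\<bar>u\<bar> ^ k\<close> into one bound with weight
  \<open>(1 + \<bar>u\<bar>) ^ k\<close>.\<close>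

lemma one_plus_abs_power_le:
  fixes u :: real
  shows "(1 + \<bar>u\<bar>) ^ k \<le> 2 ^ k * (1 + \<bar>u\<bar> ^ k)"
proof -
  have "(1 + \<bar>u\<bar>) ^ k \<le> (2 * max 1 \<bar>u\<bar>) ^ k"
    by (intro power_mono) auto
  also have "\<dots> = 2 ^ k * max 1 \<bar>u\<bar> ^ k"
    by (simp add: power_mult_distrib)
  also have "\<dots> \<le> 2 ^ k * (1 + \<bar>u\<bar> ^ k)"
    by (auto simp: max_def)
  finally show ?thesis .
qed

lemma integrable_inverse_one_plus_square_UNIV:
  "integrable lborel (\<lambda>x::real. inverse (1 + x\<^sup>2))"
  using integrable_inverse_1_plus_square by (simp add: set_integrable_def)

text \<open>The power of \<open>max 0 (1 - x\<^sup>2)\<close> is taken to be \<open>m + 2\<close>: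
  its transform then decays like \<open>(1 + \<bar>u\<bar>) ^ (m + 2)\<close> in the denominator,
  and the two powers beyond \<open>m\<close> leave an integrable majorant. By inversion,
  \<open>g\<close> is this transform divided by \<open>2 * pi\<close>.\<close>

lemma bump_fourier:
  obtains h :: "real \<Rightarrow> real" and g :: "real \<Rightarrow> complex"
  where "continuous_on UNIV h" "\<And>x. 0 \<le> h x" "\<And>x. 0 < h x \<longleftrightarrow> \<bar>x\<bar> < 1"
    "\<And>x. h x = (LBINT u. g u * cis (u * x))"
    "g \<in> borel_measurable borel"
    "integrable lborel (\<lambda>u. (1 + \<bar>u\<bar>) ^ m * norm (g u))"
proof -
  let ?w = "[:1, 0, -1:] :: real poly"
  define k where "k = m + 2"
  define h where "h x = max 0 (1 - x\<^sup>2) ^ k" for x :: real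
  define F where "F u = (LBINT y. h y * cis (- (u * y)))" for u
  have sq: "0 < 1 - x\<^sup>2 \<longleftrightarrow> \<bar>x\<bar> < 1" for x :: real
    by (simp add: abs_square_less_1)
  \<comment> \<open>This identifies the transform of \<open>h\<close> with the integrals over
    \<open>{-1..1}\<close> bounded above. Outside the interval it relies on
    \<open>0 ^ k = 0\<close>, true as \<open>k\<close> is positive.\<close>
  have h_ind: "h x = indicator {-1..1} x * poly (?w ^ k) x" for x
  proof (cases "\<bar>x\<bar> \<le> 1")
    case True
    then have "x\<^sup>2 \<le> 1" by (simp add: abs_square_le_1)
    with True show ?thesis by (simp add: h_def power2_eq_square max_def poly_power abs_le_iff)
  next
    case False
    then have "\<not> 0 < 1 - x\<^sup>2" by (subst sq) simp
    with False show ?thesis by (auto simp: h_def max_def k_def indicator_def)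
  qed
  have h_pos: "0 < h x \<longleftrightarrow> \<bar>x\<bar> < 1" for x
  proof (cases "0 < 1 - x\<^sup>2")
    case True
    then have "0 < h x" unfolding h_def by (intro zero_less_power) simp
    with True show ?thesis using sq[of x] by blast
  next
    case False
    then have "h x = 0" by (simp add: h_def max_absorb1 k_def)
    with False show ?thesis using sq[of x] by (metis less_irrefl)
  qed
  have h_cont: "continuous_on UNIV h"
    unfolding h_def by (intro continuous_intros)
  have h_nonneg: "0 \<le> h x" for x by (simp add: h_def)
  have h_le: "\<bar>h x\<bar> \<le> 1" for x
    unfolding h_def by (auto intro!: power_le_one)
  have h_int: "integrable lborel h"
    using borel_integrable_atLeastAtMost'[of "-1" 1 "poly (?w ^ k)", OF continuous_on_poly[OF continuous_on_id]]
    by (simp only: set_integrable_def real_scaleR_def h_ind[symmetric])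
  have [measurable]: "h \<in> borel_measurable borel"
    using h_int by auto
  have F_meas [measurable]: "F \<in> borel_measurable borel"
    unfolding F_def by measurable
  have F_eq: "F u = (LBINT x:{-1..1}. poly (1 * ?w ^ k) x * cis (- (u * x)))" for u
    unfolding F_def h_ind set_lebesgue_integral_def
    by (intro Bochner_Integration.integral_cong) (auto simp: indicator_def)
  obtain C where C: "\<And>u. \<bar>u\<bar> ^ k * norm (F u) \<le> C"
    using fourier_poly_decay[of k 1] unfolding F_eq by blast
  \<comment> \<open>With exponent 0 the whole power of \<open>?w\<close> counts as the cofactor,
    which yields the plain bound on \<open>F\<close>.\<close>
  obtain D where D: "\<And>u. norm (F u) \<le> D"
    using fourier_poly_decay[of 0 "?w ^ k"] unfolding F_eq by auto
  define M where "M = 2 ^ k * (D + C)"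
  have M: "(1 + \<bar>u\<bar>) ^ k * norm (F u) \<le> M" for u
  proof -
    have "(1 + \<bar>u\<bar>) ^ k * norm (F u) \<le> 2 ^ k * (1 + \<bar>u\<bar> ^ k) * norm (F u)"
      by (intro mult_right_mono one_plus_abs_power_le) auto
    also have "\<dots> = 2 ^ k * (norm (F u) + \<bar>u\<bar> ^ k * norm (F u))"
      by (simp add: algebra_simps)
    also have "\<dots> \<le> M" unfolding M_def using C[of u] D[of u] by (intro mult_left_mono add_mono) auto
    finally show ?thesis .
  qed
  have F_m: "(1 + \<bar>u\<bar>) ^ m * norm (F u) \<le> M * inverse (1 + u\<^sup>2)" for u
  proof -
    have "M \<ge> 0" using order_trans[OF _ M[of 0]] by simp
    have "(1 + \<bar>u\<bar>) ^ m * norm (F u) * (1 + \<bar>u\<bar>)\<^sup>2 \<le> M"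
      using M[of u] unfolding k_def power_add by (simp only: mult_ac)
    moreover have "0 < (1 + \<bar>u\<bar>)\<^sup>2"
      by (intro zero_less_power) simp
    ultimately have "(1 + \<bar>u\<bar>) ^ m * norm (F u) \<le> M * inverse ((1 + \<bar>u\<bar>)\<^sup>2)"
      by (simp only: pos_le_divide_eq divide_inverse[symmetric])
    also have "\<dots> \<le> M * inverse (1 + u\<^sup>2)"
      using \<open>M \<ge> 0\<close> by (intro mult_left_mono le_imp_inverse_le) (auto simp: power2_eq_square algebra_simps add_pos_nonneg)
    finally show ?thesis .
  qed
  have F_int_m: "integrable lborel (\<lambda>u. (1 + \<bar>u\<bar>) ^ m * norm (F u))"
    by (rule Bochner_Integration.integrable_bound[where f = "\<lambda>u. M * inverse (1 + u\<^sup>2)"])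
      (use integrable_inverse_one_plus_square_UNIV F_m in \<open>auto intro!: order_trans[OF F_m]\<close>)
  have "norm (F u) \<le> (1 + \<bar>u\<bar>) ^ m * norm (F u)" for u
    using mult_right_mono[OF one_le_power[of "1 + \<bar>u\<bar>" m], of "norm (F u)"] by simp
  then have "integrable lborel F"
    by (intro Bochner_Integration.integrable_bound[OF F_int_m]) auto
  then have inv: "h x = (LBINT u. F u / (2 * pi) * cis (u * x))" for x
    using fourier_inversion[OF h_cont h_le h_int, of x, folded F_def] by simp
  show ?thesis
  proof (rule that[OF h_cont h_nonneg h_pos inv])
    show "integrable lborel (\<lambda>u. (1 + \<bar>u\<bar>) ^ m * norm (F u / (2 * pi)))"
      using F_int_m by (simp add: norm_divide)
  qed measurable
qed

section \<open>Decay under multiplication by a bump in one coordinate\<close>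

text \<open>The decay condition is restated with \<open>(1 + norm \<xi>) powr (-a)\<close> in place of
  \<open>norm \<xi> powr (-a)\<close> because the translates of the former are comparable to it.\<close>
lemma one_plus_norm_powr_shift:
  fixes x v :: "'a::real_normed_vector"
  assumes "0 \<le> a"
  shows "(1 + norm (x - v)) powr (-a) \<le> (1 + norm v) powr a * (1 + norm x) powr (-a)"
proof -
  have "norm x \<le> norm (x - v) + norm v"
    using norm_triangle_ineq[of "x - v" v] by simp
  then have "1 + norm x \<le> (1 + norm (x - v)) * (1 + norm v)"
    using mult_nonneg_nonneg[OF norm_ge_zero[of "x - v"] norm_ge_zero[of v]]
    unfolding distrib_left distrib_right by linarith
  then have "(1 + norm x) powr a \<le> ((1 + norm (x - v)) * (1 + norm v)) powr a"
    using assms by (intro powr_mono2) auto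
  then have "(1 + norm x) powr a \<le> (1 + norm (x - v)) powr a * (1 + norm v) powr a"
    by (simp only: powr_mult)
  moreover have "0 < (1 + norm x) powr a" "0 < (1 + norm (x - v)) powr a"
    by (simp_all add: add_pos_nonneg order_less_imp_not_eq2)
  ultimately show ?thesis
    unfolding powr_minus by (simp add: field_simps del: powr_gt_zero)
qed

text \<open>Inserting the integral for \<open>h\<close> and exchanging integrals writes the new
  transform as a superposition of translates of the old one along \<open>b\<close>. The
  \<open>m\<close>-th moment of \<open>g\<close> absorbs the growth of the translation constants
  because \<open>a \<le> m\<close>. The factor \<open>w\<close> allows iteration over the
  coordinates.\<close>

lemma decay_mult_wave:
  fixes \<mu> :: "'a::euclidean_space measure" and w :: "'a \<Rightarrow> real"
    and h :: "real \<Rightarrow> real" and g :: "real \<Rightarrow> complex"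
  assumes "finite_measure \<mu>" and sets [measurable_cong]: "sets \<mu> = sets borel"
    and w [measurable]: "w \<in> borel_measurable borel" and w_le: "\<And>x. \<bar>w x\<bar> \<le> B"
    and h: "\<And>t. h t = (LBINT u. g u * cis (u * t))"
    and g [measurable]: "g \<in> borel_measurable borel"
    and g_int: "integrable lborel (\<lambda>u. (1 + \<bar>u\<bar>) ^ m * norm (g u))"
    and b: "norm b = 1" and d: "d > 0" and a: "0 \<le> a" "a \<le> real m"
    and decay: "\<And>\<xi>. norm (LINT x|\<mu>. w x * cis (- (2 * pi * (\<xi> \<bullet> x)))) \<le> C * (1 + norm \<xi>) powr (-a)"
  shows "\<exists>C. \<forall>\<xi>. norm (LINT x|\<mu>. (w x * h (((x - p) \<bullet> b) / d)) * cis (- (2 * pi * (\<xi> \<bullet> x))))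
      \<le> C * (1 + norm \<xi>) powr (-a)"
proof (intro exI allI)
  fix \<xi> :: 'a
  interpret finite_measure \<mu> by fact
  interpret pair_sigma_finite lborel \<mu> ..
  \<comment> \<open>The wave \<open>cis (u * t)\<close> at
    \<open>t = ((x - p) \<bullet> b) / d\<close> shifts the frequency by
    \<open>(k * u) *\<^sub>R b\<close>; the centre \<open>p\<close> contributes only the phase
    \<open>?e u\<close> of modulus 1.\<close>
  define k where "k = 1 / (2 * pi * d)"
  define T where "T \<eta> = (LINT x|\<mu>. w x * cis (- (2 * pi * (\<eta> \<bullet> x))))" for \<eta>
  define M where "M = (LBINT u. (1 + \<bar>u\<bar>) ^ m * norm (g u))"
  have "k > 0" using d by (simp add: k_def)
  have "B \<ge> 0" using w_le[of 0] by linarith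
  have "C \<ge> 0" using order_trans[OF norm_ge_zero decay[of 0]] by simp
  have g_le: "norm (g u) \<le> (1 + \<bar>u\<bar>) ^ m * norm (g u)" for u
    using mult_right_mono[OF one_le_power[of "1 + \<bar>u\<bar>" m], of "norm (g u)"] by simp
  have g_abs: "integrable lborel (\<lambda>u. norm (g u))"
    by (rule Bochner_Integration.integrable_bound[OF g_int]) (use g_le in auto)
  let ?e = "\<lambda>u. cis (- (u * (p \<bullet> b) / d))"
  have "(LINT x|\<mu>. (w x * h (((x - p) \<bullet> b) / d)) * cis (- (2 * pi * (\<xi> \<bullet> x))))
      = (LINT x|\<mu>. (LBINT u. g u * ?e u * (w x * cis (- (2 * pi * ((\<xi> - (k * u) *\<^sub>R b) \<bullet> x))))))"
  proof (rule Bochner_Integration.integral_cong)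
    fix x
    have "cis (u * (((x - p) \<bullet> b) / d)) * cis (- (2 * pi * (\<xi> \<bullet> x)))
        = ?e u * cis (- (2 * pi * ((\<xi> - (k * u) *\<^sub>R b) \<bullet> x)))" for u
      unfolding cis_mult using d
      by (intro arg_cong[of _ _ cis], unfold inner_diff_left inner_scaleR_left inner_commute[of b x])
        (simp add: k_def field_simps)
    note eq = this
    have "(w x * h (((x - p) \<bullet> b) / d)) * cis (- (2 * pi * (\<xi> \<bullet> x)))
        = (LBINT u. w x * (g u * (cis (u * (((x - p) \<bullet> b) / d)) * cis (- (2 * pi * (\<xi> \<bullet> x))))))"
      by (simp add: h mult.assoc flip: integral_mult_left_zero)
    then show "(w x * h (((x - p) \<bullet> b) / d)) * cis (- (2 * pi * (\<xi> \<bullet> x)))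
        = (LBINT u. g u * ?e u * (w x * cis (- (2 * pi * ((\<xi> - (k * u) *\<^sub>R b) \<bullet> x)))))"
      unfolding eq by (simp only: mult_ac)
  qed simp
  also have "\<dots> = (LBINT u. LINT x|\<mu>. g u * ?e u * (w x * cis (- (2 * pi * ((\<xi> - (k * u) *\<^sub>R b) \<bullet> x)))))"
    by (rule Fubini_integral_dominated[where a = "\<lambda>u. norm (g u)" and b = "\<lambda>_. B"])
      (use g_abs w_le in \<open>auto simp: norm_mult mult_left_mono\<close>)
  also have "\<dots> = (LBINT u. g u * ?e u * T (\<xi> - (k * u) *\<^sub>R b))"
    by (simp add: T_def)
  finally have eq: "(LINT x|\<mu>. (w x * h (((x - p) \<bullet> b) / d)) * cis (- (2 * pi * (\<xi> \<bullet> x))))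
      = (LBINT u. g u * ?e u * T (\<xi> - (k * u) *\<^sub>R b))" .
  \<comment> \<open>The factor \<open>(1 + k) ^ m\<close> comes from
    \<open>1 + k * \<bar>u\<bar> \<le> (1 + k) * (1 + \<bar>u\<bar>)\<close>, which separates the
    scale from the moment weight.\<close>
  let ?K = "C * (1 + k) ^ m * (1 + norm \<xi>) powr (-a)"
  have bound: "norm (g u * ?e u * T (\<xi> - (k * u) *\<^sub>R b)) \<le> ?K * ((1 + \<bar>u\<bar>) ^ m * norm (g u))" for u
  proof -
    let ?v = "(k * u) *\<^sub>R b"
    have v: "norm ?v = k * \<bar>u\<bar>" using b \<open>k > 0\<close> by (simp add: abs_mult)
    have "(1 + norm ?v) powr a \<le> (1 + norm ?v) powr (real m)"
      using a by (intro powr_mono) auto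
    also have "\<dots> = (1 + k * \<bar>u\<bar>) ^ m"
      unfolding v using \<open>k > 0\<close> by (subst powr_realpow) (auto simp: add_pos_nonneg)
    also have "\<dots> \<le> ((1 + k) * (1 + \<bar>u\<bar>)) ^ m"
      using \<open>k > 0\<close> by (intro power_mono) (auto simp: algebra_simps)
    finally have *: "(1 + norm ?v) powr a \<le> (1 + k) ^ m * (1 + \<bar>u\<bar>) ^ m"
      by (simp add: power_mult_distrib)
    have "norm (T (\<xi> - ?v)) \<le> C * ((1 + norm ?v) powr a * (1 + norm \<xi>) powr (-a))"
      using order_trans[OF decay[of "\<xi> - ?v"] mult_left_mono[OF one_plus_norm_powr_shift[OF a(1)] \<open>C \<ge> 0\<close>]]
      by (simp only: T_def)
    also have "\<dots> \<le> C * (((1 + k) ^ m * (1 + \<bar>u\<bar>) ^ m) * (1 + norm \<xi>) powr (-a))"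
      using * \<open>C \<ge> 0\<close> by (intro mult_left_mono mult_right_mono) auto
    finally have "norm (g u) * norm (T (\<xi> - ?v))
        \<le> norm (g u) * (C * (((1 + k) ^ m * (1 + \<bar>u\<bar>) ^ m) * (1 + norm \<xi>) powr (-a)))"
      by (rule mult_left_mono) simp
    then show ?thesis
      by (simp only: norm_mult norm_cis mult_1_right mult_ac)
  qed
  have "norm (LBINT u. g u * ?e u * T (\<xi> - (k * u) *\<^sub>R b)) \<le> (LBINT u. ?K * ((1 + \<bar>u\<bar>) ^ m * norm (g u)))"
  proof (rule Bochner_Integration.integral_norm_bound_integral)
    show K_int: "integrable lborel (\<lambda>u. ?K * ((1 + \<bar>u\<bar>) ^ m * norm (g u)))"
      by (intro integrable_mult_right g_int)
    show "integrable lborel (\<lambda>u. g u * ?e u * T (\<xi> - (k * u) *\<^sub>R b))"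
    proof (rule Bochner_Integration.integrable_bound[OF K_int])
      show "(\<lambda>u. g u * ?e u * T (\<xi> - (k * u) *\<^sub>R b)) \<in> borel_measurable lborel"
        unfolding T_def by measurable
      show "AE u in lborel. norm (g u * ?e u * T (\<xi> - (k * u) *\<^sub>R b)) \<le> norm (?K * ((1 + \<bar>u\<bar>) ^ m * norm (g u)))"
        by (intro AE_I2 order_trans[OF bound]) simp
    qed
  qed (rule bound)
  also have "\<dots> = ?K * M"
    by (simp add: M_def)
  finally show "norm (LINT x|\<mu>. (w x * h (((x - p) \<bullet> b) / d)) * cis (- (2 * pi * (\<xi> \<bullet> x))))
      \<le> (C * (1 + k) ^ m * M) * (1 + norm \<xi>) powr (-a)"
    unfolding eq by (simp only: mult_ac)
qed

section \<open>Localization of measures with Fourier decay\<close>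

lemma fourier_measure_cis: "fourier_measure \<mu> \<xi> = (LINT x|\<mu>. cis (- (2 * pi * (\<xi> \<bullet> x))))"
  unfolding fourier_measure_def cis_conv_exp by (simp add: mult_ac)

lemma norm_fourier_measure_le_1:
  assumes "prob_space M"
  shows "norm (fourier_measure M \<xi>) \<le> 1"
proof -
  interpret prob_space M by fact
  have "norm (fourier_measure M \<xi>) \<le> (LINT x|M. norm (cis (- (2 * pi * (\<xi> \<bullet> x)))))"
    unfolding fourier_measure_cis by (rule integral_norm_bound)
  then show ?thesis by (simp add: prob_space)
qed

text \<open>For nonzero frequencies the two sides of the decay condition are comparable: for \<open>norm \<xi> < 1\<close>
  by the trivial bound \<open>1\<close>, for \<open>norm \<xi> \<ge> 1\<close> since then \<open>1 + norm \<xi> \<le> 2 * norm \<xi>\<close>.\<close>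
lemma fourier_decay_iff_one_plus:
  fixes s :: real
  assumes "prob_space M" "0 \<le> s"
  shows "fourier_decay M s \<longleftrightarrow> (\<exists>C. \<forall>\<xi>. norm (fourier_measure M \<xi>) \<le> C * (1 + norm \<xi>) powr (- (s / 2)))"
proof
  assume "fourier_decay M s"
  then obtain C where C: "\<And>\<xi>. \<xi> \<noteq> 0 \<Longrightarrow> norm (fourier_measure M \<xi>) \<le> C * norm \<xi> powr (- s / 2)"
    unfolding fourier_decay_def by blast
  \<comment> \<open>\<open>max 1 C\<close> serves both the trivial bound and the given one;
    \<open>2 powr (s / 2)\<close> pays for \<open>1 + norm \<xi> \<le> 2\<close> in the first case
    and \<open>1 + norm \<xi> \<le> 2 * norm \<xi>\<close> in the second.\<close>
  have "norm (fourier_measure M \<xi>) \<le> (max 1 C * 2 powr (s / 2)) * (1 + norm \<xi>) powr (- (s / 2))" for \<xi>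
  proof (cases "norm \<xi> < 1")
    case True
    have "norm (fourier_measure M \<xi>) \<le> 1" using assms(1) by (rule norm_fourier_measure_le_1)
    also have "1 = 2 powr (s / 2) * 2 powr (- (s / 2))" by (simp flip: powr_add)
    also have "\<dots> \<le> 2 powr (s / 2) * (1 + norm \<xi>) powr (- (s / 2))"
      using True assms by (intro mult_left_mono powr_mono2') (auto simp: add_pos_nonneg)
    also have "\<dots> \<le> max 1 C * (2 powr (s / 2) * (1 + norm \<xi>) powr (- (s / 2)))"
      by (rule mult_right_mono[of 1 "max 1 C", unfolded mult_1_left]) auto
    finally show ?thesis by (simp only: mult.assoc)
  next
    case False
    then have "\<xi> \<noteq> 0" by auto
    then have "norm (fourier_measure M \<xi>) \<le> C * norm \<xi> powr (- (s / 2))"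
      using C by simp
    also have "\<dots> \<le> max 1 C * norm \<xi> powr (- (s / 2))"
      by (intro mult_right_mono) auto
    also have "\<dots> \<le> max 1 C * ((1 + norm \<xi>) / 2) powr (- (s / 2))"
      using False assms by (intro mult_left_mono powr_mono2') (auto simp: add_pos_nonneg)
    also have "\<dots> = max 1 C * 2 powr (s / 2) * (1 + norm \<xi>) powr (- (s / 2))"
      by (simp add: powr_divide powr_minus field_simps)
    finally show ?thesis .
  qed
  then show "\<exists>C. \<forall>\<xi>. norm (fourier_measure M \<xi>) \<le> C * (1 + norm \<xi>) powr (- (s / 2))" by blast
next
  assume "\<exists>C. \<forall>\<xi>. norm (fourier_measure M \<xi>) \<le> C * (1 + norm \<xi>) powr (- (s / 2))"
  then obtain C where C: "\<And>\<xi>. norm (fourier_measure M \<xi>) \<le> C * (1 + norm \<xi>) powr (- (s / 2))" by blast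
  have "C \<ge> 0" using order_trans[OF norm_ge_zero C[of 0]] by simp
  have "norm (fourier_measure M \<xi>) \<le> C * norm \<xi> powr (- s / 2)" if "\<xi> \<noteq> 0" for \<xi>
    using order_trans[OF C mult_left_mono[OF powr_mono2'[of "- (s / 2)" "norm \<xi>" "1 + norm \<xi>"] \<open>C \<ge> 0\<close>]] that assms
    by simp
  then show "fourier_decay M s" unfolding fourier_decay_def by blast
qed

text \<open>The density is a product of one-dimensional bumps centred at \<open>p\<close>, one per
  coordinate, each of which preserves the decay. Absolute continuity is recorded so that sets of
  full \<open>\<mu>\<close>-measure keep full measure.\<close>

lemma fourier_decay_localize:
  fixes \<mu> :: "'a::euclidean_space measure"
  assumes prob: "prob_space \<mu>" and sets [measurable_cong]: "sets \<mu> = sets borel"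
    and decay: "fourier_decay \<mu> s" and s: "0 \<le> s" and r: "r > 0"
    and supp: "\<And>d. d > 0 \<Longrightarrow> emeasure \<mu> (ball p d) \<noteq> 0"
  obtains \<nu> where "prob_space \<nu>" "sets \<nu> = sets borel" "fourier_decay \<nu> s"
    "absolutely_continuous \<mu> \<nu>" "AE x in \<nu>. x \<in> cball p r"
proof -
  interpret prob_space \<mu> by fact
  \<comment> \<open>The number of moments of \<open>g\<close> must be at least the decay exponent
    \<open>s / 2\<close>.\<close>
  define m where "m = nat \<lceil>s / 2\<rceil>"
  have m: "s / 2 \<le> real m" unfolding m_def by linarith
  obtain h g where h_cont: "continuous_on UNIV h" and h_nonneg: "\<And>x. 0 \<le> h x"
    and h_pos: "\<And>x. 0 < h x \<longleftrightarrow> \<bar>x\<bar> < 1"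
    and h: "\<And>x. complex_of_real (h x) = (LBINT u. g u * cis (u * x))"
    and g: "g \<in> borel_measurable borel"
    and g_int: "integrable lborel (\<lambda>u. (1 + \<bar>u\<bar>) ^ m * norm (g u))"
    using bump_fourier[of m] by blast
  \<comment> \<open>On a cube of half-side \<open>d\<close> about \<open>p\<close>, the l1 norm of
    \<open>x - p\<close> is at most \<open>DIM('a) * d = r\<close>, so the cube lies in
    \<open>cball p r\<close>.\<close>
  define d where "d = r / DIM('a)"
  have d: "d > 0" using r by (simp add: d_def)
  \<comment> \<open>Subsets \<open>J\<close> of the basis allow induction on the coordinates; the
    empty product 1 gives back \<open>\<mu>\<close> itself.\<close>
  define \<phi> where "\<phi> J x = (\<Prod>b\<in>J. h (((x - p) \<bullet> b) / d))" for J :: "'a set" and x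
  have h_meas [measurable]: "h \<in> borel_measurable borel"
    by (intro borel_measurable_continuous_onI h_cont)
  have \<phi>_meas [measurable]: "\<phi> J \<in> borel_measurable borel" for J
    unfolding \<phi>_def by measurable
  have "\<exists>B. \<forall>x. \<bar>h x\<bar> \<le> B"
  proof -
    have "compact (h ` {-1..1})"
      by (intro compact_continuous_image continuous_on_subset[OF h_cont]) auto
    then obtain B where B: "\<And>y. y \<in> h ` {-1..1} \<Longrightarrow> norm y \<le> B"
      by (meson compact_imp_bounded bounded_iff)
    have "\<bar>h x\<bar> \<le> B" for x
    proof (cases "\<bar>x\<bar> < 1")
      case True
      then have "x \<in> {-1..1}" by auto
      then show ?thesis using B[OF imageI[of x "{-1..1}" h]] by simp
    next
      case False
      then have "h x = 0" using h_pos[of x] h_nonneg[of x] by auto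
      then show ?thesis using B[of "h 0"] by auto
    qed
    then show ?thesis by blast
  qed
  then obtain B where B: "\<And>x. \<bar>h x\<bar> \<le> B" by blast
  have \<phi>_le: "\<bar>\<phi> J x\<bar> \<le> B ^ card J" for J x
  proof -
    have "\<bar>\<phi> J x\<bar> \<le> (\<Prod>b\<in>J. B)"
      unfolding \<phi>_def abs_prod by (intro prod_mono) (auto simp: B)
    then show ?thesis by simp
  qed
  have \<phi>_nonneg: "0 \<le> \<phi> J x" for J x
    unfolding \<phi>_def by (intro prod_nonneg) (simp add: h_nonneg)
  have "\<exists>C. \<forall>\<xi>. norm (LINT x|\<mu>. \<phi> J x * cis (- (2 * pi * (\<xi> \<bullet> x)))) \<le> C * (1 + norm \<xi>) powr (- (s / 2))"
    if "J \<subseteq> Basis" for J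
    using finite_subset[OF that finite_Basis] that
  proof (induction J)
    case empty
    then show ?case
      using fourier_decay_iff_one_plus[OF prob s] decay by (simp add: \<phi>_def fourier_measure_cis)
  next
    case (insert b J)
    then obtain C where C: "\<And>\<xi>. norm (LINT x|\<mu>. \<phi> J x * cis (- (2 * pi * (\<xi> \<bullet> x)))) \<le> C * (1 + norm \<xi>) powr (- (s / 2))"
      by auto
    have \<phi>: "\<phi> (insert b J) x = \<phi> J x * h (((x - p) \<bullet> b) / d)" for x
      using insert by (simp add: \<phi>_def mult.commute)
    show ?case
      unfolding \<phi>
    proof (rule decay_mult_wave[OF finite_measure_axioms sets \<phi>_meas \<phi>_le _ g g_int _ d _ m])
      show "complex_of_real (h t) = (LBINT u. g u * cis (u * t))" for t by (rule h)
      show "norm b = 1" using insert by simp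
    qed (use s C in auto)
  qed
  then obtain C where C: "\<And>\<xi>. norm (LINT x|\<mu>. \<phi> Basis x * cis (- (2 * pi * (\<xi> \<bullet> x)))) \<le> C * (1 + norm \<xi>) powr (- (s / 2))"
    by blast
  have \<phi>_ball: "\<phi> Basis x > 0" if "x \<in> ball p d" for x
  proof -
    have "\<bar>(x - p) \<bullet> b\<bar> < d" if "b \<in> Basis" for b
      using Basis_le_norm[OF that, of "x - p"] \<open>x \<in> ball p d\<close> by (simp add: dist_norm norm_minus_commute)
    then show ?thesis
      unfolding \<phi>_def using d by (intro prod_pos) (simp add: h_pos abs_divide)
  qed
  have \<phi>_cball: "x \<in> cball p r" if "\<phi> Basis x \<noteq> 0" for x
  proof -
    have "\<bar>(x - p) \<bullet> b\<bar> \<le> d" if "b \<in> Basis" for b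
    proof -
      have "h (((x - p) \<bullet> b) / d) \<noteq> 0"
        using \<open>\<phi> Basis x \<noteq> 0\<close> that by (auto simp: \<phi>_def)
      then have "0 < h (((x - p) \<bullet> b) / d)" using h_nonneg[of "((x - p) \<bullet> b) / d"] by linarith
      then show ?thesis using d by (simp add: h_pos abs_divide)
    qed
    then have "(\<Sum>b\<in>Basis. \<bar>(x - p) \<bullet> b\<bar>) \<le> (\<Sum>b\<in>(Basis::'a set). d)"
      by (rule sum_mono)
    then show ?thesis
      using norm_le_l1[of "x - p"] by (simp add: d_def dist_norm norm_minus_commute)
  qed
  have \<phi>_int: "integrable \<mu> (\<phi> Basis)"
    by (rule integrable_const_bound[where B = "B ^ card (Basis :: 'a set)"]) (auto simp: \<phi>_le)
  define c where "c = (LINT x|\<mu>. \<phi> Basis x)"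
  \<comment> \<open>The density is positive on \<open>ball p d\<close>, which has positive mass by
    the assumption on \<open>p\<close>.\<close>
  have "c \<noteq> 0"
  proof
    assume "c = 0"
    then have "AE x in \<mu>. \<phi> Basis x = 0"
      unfolding c_def using integral_nonneg_eq_0_iff_AE[OF \<phi>_int] \<phi>_nonneg by simp
    then have "AE x in \<mu>. x \<notin> ball p d"
      by eventually_elim (use \<phi>_ball in force)
    then have "emeasure \<mu> (ball p d) = 0"
      using AE_iff_measurable[of "ball p d" \<mu> "\<lambda>x. x \<notin> ball p d"] sets_eq_imp_space_eq[OF sets]
      by (simp add: sets del: mem_ball)
    with supp[OF d] show False by simp
  qed
  moreover have "c \<ge> 0" unfolding c_def by (simp add: \<phi>_nonneg)
  ultimately have c: "c > 0" by simp
  define \<nu> where "\<nu> = density \<mu> (\<lambda>x. ennreal (\<phi> Basis x / c))"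
  have density_nonneg: "AE x in \<mu>. 0 \<le> \<phi> Basis x / c"
    using \<phi>_nonneg c by simp
  show ?thesis
  proof (rule that)
    show \<nu>_prob: "prob_space \<nu>"
    proof
      have "emeasure \<nu> (space \<nu>) = (\<integral>\<^sup>+ x. ennreal (\<phi> Basis x / c) \<partial>\<mu>)"
        unfolding \<nu>_def by (subst emeasure_density) (auto intro!: nn_integral_cong)
      also have "\<dots> = ennreal (LINT x|\<mu>. \<phi> Basis x / c)"
        by (rule nn_integral_eq_integral) (use \<phi>_int density_nonneg in auto)
      also have "\<dots> = 1" using c by (simp add: c_def[symmetric])
      finally show "emeasure \<nu> (space \<nu>) = 1" .
    qed
    show "sets \<nu> = sets borel" by (simp add: \<nu>_def sets)
    show "absolutely_continuous \<mu> \<nu>"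
      unfolding \<nu>_def by (rule absolutely_continuousI_density) measurable
    show "AE x in \<nu>. x \<in> cball p r"
    proof -
      have "0 < ennreal (\<phi> Basis x / c) \<longrightarrow> x \<in> cball p r" for x
        using \<phi>_cball[of x] by (cases "\<phi> Basis x = 0") (simp_all del: mem_cball)
      then show ?thesis unfolding \<nu>_def by (subst AE_density) (simp_all del: mem_cball)
    qed
    have "fourier_measure \<nu> \<xi> = (LINT x|\<mu>. \<phi> Basis x * cis (- (2 * pi * (\<xi> \<bullet> x)))) / c" for \<xi>
    proof -
      have "fourier_measure \<nu> \<xi> = (LINT x|\<mu>. (\<phi> Basis x / c) *\<^sub>R cis (- (2 * pi * (\<xi> \<bullet> x))))"
        unfolding fourier_measure_cis \<nu>_def
        by (rule integral_density) (use density_nonneg in measurable)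
      then show ?thesis by (simp add: scaleR_conv_of_real)
    qed
    then have "norm (fourier_measure \<nu> \<xi>) \<le> (C / c) * (1 + norm \<xi>) powr (- (s / 2))" for \<xi>
      using divide_right_mono[OF C, of c \<xi>] c by (simp add: norm_divide)
    then show "fourier_decay \<nu> s"
      using fourier_decay_iff_one_plus[OF \<nu>_prob s] by blast
  qed
qed

section \<open>Supports and Baire's theorem\<close>

text \<open>\<open>S\<close> is the complement of the union of all open null sets. By Lindelof a
  countable subfamily has the same union, so that union is null.\<close>

lemma measure_support:
  fixes \<mu> :: "'a::second_countable_topology measure"
  assumes sets: "sets \<mu> = sets borel"
  obtains S where "closed S" "- S \<in> null_sets \<mu>"
    "\<And>x U. x \<in> S \<Longrightarrow> open U \<Longrightarrow> x \<in> U \<Longrightarrow> emeasure \<mu> U \<noteq> 0"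
proof -
  let ?N = "{U. open U \<and> emeasure \<mu> U = 0}"
  obtain N where N: "N \<subseteq> ?N" "countable N" "\<Union>N = \<Union>?N"
    using Lindelof[of ?N] by auto
  have "(\<Union>U\<in>N. U) \<in> null_sets \<mu>"
    using N by (intro null_sets_UN') (auto simp: null_sets_def sets)
  then have "\<Union>?N \<in> null_sets \<mu>" using N by simp
  then show ?thesis
    by (intro that[of "- \<Union>?N"]) (auto simp: closed_def)
qed

text \<open>Each \<open>S - A k\<close> is relatively open in \<open>S\<close>. If all were dense in
  \<open>S\<close>, so would be their intersection, which is empty because the \<open>A k\<close>
  cover \<open>S\<close>.\<close>

lemma closed_cover_contains_relative_ball:
  fixes S :: "'a::euclidean_space set"
  assumes "closed S" "S \<noteq> {}" "countable I" and A: "\<And>k. k \<in> I \<Longrightarrow> closed (A k)"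
    and S: "S \<subseteq> (\<Union>k\<in>I. A k)"
  obtains k x r where "k \<in> I" "x \<in> S" "r > 0" "S \<inter> cball x r \<subseteq> A k"
proof -
  have "\<exists>k\<in>I. \<not> S \<subseteq> closure (S - A k)"
  proof (rule ccontr)
    assume "\<not> ?thesis"
    then have "S \<subseteq> closure (\<Inter>k\<in>I. S - A k)"
      using assms
      by (intro Baire) (auto simp: Diff_eq intro!: openin_open_Int open_Compl)
    moreover have "(\<Inter>k\<in>I. S - A k) = {}"
    proof -
      \<comment> \<open>An index is required because an intersection over no indices would be the
        whole space.\<close>
      obtain i where "i \<in> I" using S \<open>S \<noteq> {}\<close> by auto
      then show ?thesis using S by blast
    qed
    ultimately show False using \<open>S \<noteq> {}\<close> by simp
  qed
  then obtain k x where k: "k \<in> I" and x: "x \<in> S" "x \<in> - closure (S - A k)" by blast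
  then obtain r where "r > 0" "cball x r \<subseteq> - closure (S - A k)"
    by (meson closed_closure open_Compl open_contains_cball)
  then show ?thesis
    using k x closure_subset[of "S - A k"] by (intro that[of k x r]) blast+
qed

section \<open>From the union to a single member\<close>

text \<open>Localization keeps the exponent \<open>s\<close> exactly, so an exponent admissible for
  the union is admissible for one of its members. The carrier \<open>L\<close> is the part of the
  support in \<open>K\<close> that lies in a small closed ball.\<close>

lemma decay_measure_on_member:
  fixes A :: "'i \<Rightarrow> 'a::euclidean_space set"
  assumes I: "countable I" and A: "\<And>k. k \<in> I \<Longrightarrow> closed (A k)"
    and K: "compact K" "K \<subseteq> (\<Union>k\<in>I. A k)" and \<mu>: "\<mu> \<in> borel_probs K"
    and decay: "fourier_decay \<mu> s" and s: "0 \<le> s"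
  obtains k L \<nu> where "k \<in> I" "compact L" "L \<subseteq> A k" "\<nu> \<in> borel_probs L" "fourier_decay \<nu> s"
proof -
  from \<mu> have sets: "sets \<mu> = sets borel" and prob: "prob_space \<mu>" and \<mu>K: "emeasure \<mu> K = 1"
    by (auto simp: borel_probs_def)
  interpret prob_space \<mu> by fact
  have space: "space \<mu> = UNIV" using sets_eq_imp_space_eq[OF sets] by simp
  obtain S where S: "closed S" "- S \<in> null_sets \<mu>"
    and supp: "\<And>x U. x \<in> S \<Longrightarrow> open U \<Longrightarrow> x \<in> U \<Longrightarrow> emeasure \<mu> U \<noteq> 0"
    using measure_support[OF sets] by metis
  have "AE x in \<mu>. x \<in> K"
    using \<mu>K K(1) sets by (intro AE_prob_1) (simp add: measure_def)
  then have AE: "AE x in \<mu>. x \<in> S \<inter> K"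
    using AE_not_in[OF S(2)] by eventually_elim auto
  then have "emeasure \<mu> (S \<inter> K) = 1"
    using S K by (intro emeasure_eq_1_AE) (simp_all add: sets compact_imp_closed)
  then have ne: "S \<inter> K \<noteq> {}" by auto
  \<comment> \<open>Baire's theorem is applied to \<open>S \<inter> K\<close>: points of
    \<open>S\<close> have neighbourhoods of positive mass only, and \<open>K\<close> is covered by
    the \<open>A k\<close>.\<close>
  obtain k p r where k: "k \<in> I" and p: "p \<in> S \<inter> K" and r: "r > 0"
    and sub: "(S \<inter> K) \<inter> cball p r \<subseteq> A k"
  proof (rule closed_cover_contains_relative_ball[of "S \<inter> K" I A])
    show "closed (S \<inter> K)" by (rule closed_Int[OF S(1) compact_imp_closed[OF K(1)]])
    show "S \<inter> K \<subseteq> (\<Union>k\<in>I. A k)" using K(2) by blast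
  qed (use ne I A that in auto)
  have "emeasure \<mu> (ball p d) \<noteq> 0" if "d > 0" for d
    using supp[of p "ball p d"] p that by simp
  then obtain \<nu> where \<nu>: "prob_space \<nu>" "sets \<nu> = sets borel" "fourier_decay \<nu> s"
    and ac: "absolutely_continuous \<mu> \<nu>" and cball: "AE x in \<nu>. x \<in> cball p r"
    using fourier_decay_localize[OF prob sets decay s r] by metis
  let ?L = "(S \<inter> K) \<inter> cball p r"
  have L: "compact ?L" by (rule compact_Int_closed[OF closed_Int_compact[OF S(1) K(1)] closed_cball])
  have "AE x in \<nu>. x \<in> S \<inter> K"
    by (rule absolutely_continuous_AE[OF _ ac AE]) (simp add: sets \<nu>)
  with cball have "AE x in \<nu>. x \<in> ?L" by eventually_elim auto
  then have "emeasure \<nu> ?L = 1"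
    using borel_compact[OF L] by (intro prob_space.emeasure_eq_1_AE[OF \<nu>(1)]) (simp_all only: \<nu>)
  then have "\<nu> \<in> borel_probs ?L" using \<nu> by (simp add: borel_probs_def)
  then show ?thesis using that[OF k L sub] \<nu>(3) by blast
qed

theorem proposition5:
  fixes A :: "'i \<Rightarrow> 'a::euclidean_space set" and I :: "'i set"
  assumes "countable I"
    and "\<And>k. k \<in> I \<Longrightarrow> closed (A k)"
  shows "compact_fourier_dim (\<Union>k\<in>I. A k) = dim_Sup ((\<lambda>k. compact_fourier_dim (A k)) ` I)"
proof -
  define D where "D B = {s \<in> {0..real DIM('a)}.
     \<exists>K \<mu>. compact K \<and> K \<subseteq> B \<and> \<mu> \<in> borel_probs K \<and> fourier_decay \<mu> s}" for B :: "'a set"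
  have dim: "compact_fourier_dim B = dim_Sup (D B)" for B :: "'a set"
    by (simp add: compact_fourier_dim_def D_def)
  have bdd: "bdd_above (D B)" for B
    unfolding D_def by (rule bdd_aboveI[of _ "real DIM('a)"]) auto
  have dim_ge: "s \<le> compact_fourier_dim B" if "s \<in> D B" for s B
    using that cSup_upper[OF that bdd] by (auto simp: dim dim_Sup_def)
  \<comment> \<open>The condition \<open>0 \<le> c\<close> covers an empty \<open>D B\<close>, whose
    supremum is 0 by convention.\<close>
  have dim_le: "compact_fourier_dim B \<le> c" if "\<And>s. s \<in> D B \<Longrightarrow> s \<le> c" "0 \<le> c" for B c
    using that cSup_least[of "D B" c] by (auto simp: dim dim_Sup_def)
  show ?thesis
  proof (cases "I = {}")
    case True
    \<comment> \<open>No probability measure gives mass 1 to the empty set, so both sides are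
      suprema of empty sets.\<close>
    have "D {} = {}" by (auto simp: D_def borel_probs_def)
    with True show ?thesis by (simp add: dim dim_Sup_def)
  next
    case False
    let ?S = "\<Squnion>k\<in>I. compact_fourier_dim (A k)"
    have bddS: "bdd_above ((\<lambda>k. compact_fourier_dim (A k)) ` I)"
      using compact_fourier_dim_bounds[where ?'a = 'a] by (intro bdd_aboveI2[of _ _ "real DIM('a)"]) auto
    have "?S \<le> compact_fourier_dim (\<Union>k\<in>I. A k)"
    proof (rule cSUP_least[OF False], rule dim_le)
      fix k s assume "k \<in> I" "s \<in> D (A k)"
      then have "s \<in> D (\<Union>k\<in>I. A k)" unfolding D_def by blast
      then show "s \<le> compact_fourier_dim (\<Union>k\<in>I. A k)" by (rule dim_ge)
    qed (use compact_fourier_dim_bounds in auto)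
    moreover have "compact_fourier_dim (\<Union>k\<in>I. A k) \<le> ?S"
    proof (rule dim_le)
      fix s assume "s \<in> D (\<Union>k\<in>I. A k)"
      then obtain K \<mu> where s: "0 \<le> s" "s \<le> real DIM('a)" and K: "compact K" "K \<subseteq> (\<Union>k\<in>I. A k)"
        and \<mu>: "\<mu> \<in> borel_probs K" "fourier_decay \<mu> s"
        by (auto simp: D_def)
      obtain k L \<nu> where k: "k \<in> I" and "compact L" "L \<subseteq> A k" "\<nu> \<in> borel_probs L" "fourier_decay \<nu> s"
        using decay_measure_on_member[OF assms K \<mu> s(1)] by metis
      then have "s \<in> D (A k)" using s by (auto simp: D_def)
      then show "s \<le> ?S"
        by (intro cSUP_upper2[OF bddS k] dim_ge)
    next
      obtain k where "k \<in> I" using False by blast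
      then show "0 \<le> ?S"
        using compact_fourier_dim_bounds[of "A k"] by (intro cSUP_upper2[OF bddS]) auto
    qed
    ultimately show ?thesis using False by (simp add: dim_Sup_def)
  qed
qed

end
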